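(* Let $0<\beta<\infty$. Suppose that $\alpha p(p-1)\le1$ and that $\theta$ satisfies the Franz–Leone identity (see context), where $f_1,\dots,f_p$ are i.i.d. copies of the random function $f(\varepsilon)=\xi+\varepsilon\zeta$. If the distributions of $b$, $\zeta$ and $\xi$ are atomic, then the unique fixed point $\lambda'_{\nu,\beta}\in\Pr_1([-1,1])$ of $\mathcal{T}'_{\nu,\beta}$ is an atomic probability measure on $[-1,1]$.
   Context: A probability measure is *atomic* if it is a (countable) sum of point masses. Let $p\ge2$ be an integer, $\alpha>0$, $h\in\mathbb{R}$, and let $\theta:\{-1,1\}^p\to\mathbb{R}$ be a random function with $\mathbb{E}\|\theta\|_\infty^2<\infty$ and $\mathbb{E}\,\mathrm{Lip}(\theta)<\infty$, where $\mathrm{Lip}(\theta)=\sup_{x\ne y}|\theta(x)-\theta(y)|/\|x-y\|_2$. **Franz–Leone identity.** For $\beta>0$, $\exp\beta\theta(x_1,\dots,x_p)=a(1+bf_1(x_1)\cdots f_p(x_p))$ for all $x_1,\dots,x_p\in\{-1,1\}$, where $a=a(\beta)$, $b=b(\beta)$ are random, $f_1,\dots,f_p$ are copies of a random function $f:\{-1,1\}\to\mathbb{R}$ that does not depend on $\beta$, all sampled independently of each other; $a$ can be any random variable, $\mathbb{E}(-b)^n\ge0$ for all $n\ge1$, and $|bf_1(x_1)\cdots f_p(x_p)|<1$ a.s. One writes $f(\varepsilon)=\xi+\varepsilon\zeta$, with $(\xi,\zeta)$ random variables independent of $a,b$, and extends $f$ to $[-1,1]$ by this linear formula. **Operator.**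 $\Pr_1([-1,1])$ is the set of Borel probability measures on $[-1,1]$. For $\lambda\in\Pr_1([-1,1])$ let $(m_{k,i})_{k\ge1,i\le p-1}$ be i.i.d. with law $\lambda$; $(b_k)$ i.i.d. copies of $b$; $(f_{k,i})$ i.i.d. copies of $f$; $(\xi_k,\zeta_k)$ i.i.d. copies of $(\xi,\zeta)$; $\pi(\alpha p)$ Poisson with mean $\alpha p$; all independent. $\mathcal{T}'_{\nu,\beta}(\lambda)$ is the law of $$\tanh\Bigl[\sum_{k\le\pi(\alpha p)}\tanh^{-1}\frac{b_k\zeta_k\prod_{i\le p-1}f_{k,i}(m_{k,i})}{1+b_k\xi_k\prod_{i\le p-1}f_{k,i}(m_{k,i})}+\beta h\Bigr].$$ When $\alpha p(p-1)\le1$ this operator has a unique fixed point, denoted $\lambda'_{\nu,\beta}$. *)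

theory Defs
  imports "HOL-Probability.Probability"
begin

definition atomic :: "'a measure \<Rightarrow> bool" where
  "atomic \<mu> \<longleftrightarrow> (\<exists>(w :: nat \<Rightarrow> ennreal) (x :: nat \<Rightarrow> 'a).
     range x \<subseteq> space \<mu> \<and>
     (\<forall>A\<in>sets \<mu>. emeasure \<mu> A = (\<Sum>n. w n * emeasure (return \<mu> (x n)) A)))"

text \<open>Points of \<open>{-1, 1}\<^sup>p\<close> are functions on \<open>{..<p}\<close>, extended by \<open>undefined\<close>.\<close>

definition cube :: "nat \<Rightarrow> (nat \<Rightarrow> real) set" where
  "cube p = {..<p} \<rightarrow>\<^sub>E {-1, 1}"

definition sup_norm :: "nat \<Rightarrow> ((nat \<Rightarrow> real) \<Rightarrow> real) \<Rightarrow> real" where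
  "sup_norm p g = (SUP x\<in>cube p. \<bar>g x\<bar>)"

definition Lip :: "nat \<Rightarrow> ((nat \<Rightarrow> real) \<Rightarrow> real) \<Rightarrow> real" where
  "Lip p g = (SUP (x, y)\<in>{(x, y). x \<in> cube p \<and> y \<in> cube p \<and> x \<noteq> y}.
     \<bar>g x - g y\<bar> / L2_set (\<lambda>i. x i - y i) {..<p})"

text \<open>
  Here \<open>\<xi>, \<zeta>\<close> are the coefficients of the random function \<open>f(\<epsilon>) = \<xi> + \<epsilon> \<zeta>\<close>, whose law does not
  depend on \<open>\<beta>\<close>; the coefficients of its copies are \<open>\<xi>s \<beta> i, \<zeta>s \<beta> i\<close> for \<open>i < p\<close>. Since \<open>a\<close> may be
  any random variable, \<open>a \<beta>\<close> and \<open>b \<beta>\<close> are allowed to depend on each other (as they do for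
  \<open>exp (\<beta> J x) = cosh (\<beta> J) (1 + tanh (\<beta> J) x)\<close> with random \<open>J\<close>), but the pair
  \<open>(a \<beta>, b \<beta>)\<close> and the \<open>p\<close> copies are mutually independent. Integrability of \<open>(- b \<beta>) ^ n\<close> is
  required because \<open>expectation\<close> returns \<open>0\<close> on functions that are not integrable.
\<close>

definition franz_leone ::
  "'w measure \<Rightarrow> nat \<Rightarrow> ('w \<Rightarrow> (nat \<Rightarrow> real) \<Rightarrow> real) \<Rightarrow>
   (real \<Rightarrow> 'w \<Rightarrow> real) \<Rightarrow> (real \<Rightarrow> 'w \<Rightarrow> real) \<Rightarrow> ('w \<Rightarrow> real) \<Rightarrow> ('w \<Rightarrow> real) \<Rightarrow>
   (real \<Rightarrow> nat \<Rightarrow> 'w \<Rightarrow> real) \<Rightarrow> (real \<Rightarrow> nat \<Rightarrow> 'w \<Rightarrow> real) \<Rightarrow> bool" where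
  "franz_leone M p \<theta> a b \<xi> \<zeta> \<xi>s \<zeta>s \<longleftrightarrow> (\<forall>\<beta>>0.
     prob_space.indep_var M borel (\<lambda>\<omega>. (a \<beta> \<omega>, b \<beta> \<omega>)) borel (\<lambda>\<omega>. (\<xi> \<omega>, \<zeta> \<omega>)) \<and>
     prob_space.indep_vars M (\<lambda>_. borel :: (real \<times> real) measure)
       (\<lambda>j. case j of None \<Rightarrow> (\<lambda>\<omega>. (a \<beta> \<omega>, b \<beta> \<omega>)) | Some i \<Rightarrow> (\<lambda>\<omega>. (\<xi>s \<beta> i \<omega>, \<zeta>s \<beta> i \<omega>)))
       (insert None (Some ` {..<p})) \<and>
     (\<forall>i<p. distr M borel (\<lambda>\<omega>. (\<xi>s \<beta> i \<omega>, \<zeta>s \<beta> i \<omega>)) = distr M borel (\<lambda>\<omega>. (\<xi> \<omega>, \<zeta> \<omega>))) \<and>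
     (\<forall>n\<ge>1. integrable M (\<lambda>\<omega>. (- b \<beta> \<omega>) ^ n) \<and> (\<integral>\<omega>. (- b \<beta> \<omega>) ^ n \<partial>M) \<ge> 0) \<and>
     (AE \<omega> in M. \<forall>x\<in>cube p. \<bar>b \<beta> \<omega> * (\<Prod>i<p. \<xi>s \<beta> i \<omega> + x i * \<zeta>s \<beta> i \<omega>)\<bar> < 1) \<and>
     (AE \<omega> in M. \<forall>x\<in>cube p.
        exp (\<beta> * \<theta> \<omega> x) = a \<beta> \<omega> * (1 + b \<beta> \<omega> * (\<Prod>i<p. \<xi>s \<beta> i \<omega> + x i * \<zeta>s \<beta> i \<omega>))))"

definition interval_borel :: "real measure" where
  "interval_borel = restrict_space borel {-1..1}"

definition Pr1 :: "real measure set" where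
  "Pr1 = {\<mu>. prob_space \<mu> \<and> sets \<mu> = sets interval_borel}"

text \<open>
  \<open>B\<close> is the law of \<open>b\<close> and \<open>F\<close> the law of \<open>(\<xi>, \<zeta>)\<close>. The five independent components are the
  Poisson variable, \<open>(b\<^sub>k)\<close>, \<open>(\<xi>\<^sub>k, \<zeta>\<^sub>k)\<close>, the coefficients of \<open>(f\<^sub>k\<^sub>,\<^sub>i)\<close>, and \<open>(m\<^sub>k\<^sub>,\<^sub>i)\<close>;
  both indices start at \<open>0\<close>.
\<close>

definition cavity_space ::
  "nat \<Rightarrow> real \<Rightarrow> real measure \<Rightarrow> (real \<times> real) measure \<Rightarrow> real measure \<Rightarrow>
   (nat \<times> (nat \<Rightarrow> real) \<times> (nat \<Rightarrow> real \<times> real) \<times> (nat \<times> nat \<Rightarrow> real \<times> real) \<times>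
     (nat \<times> nat \<Rightarrow> real)) measure" where
  "cavity_space p \<alpha> B F \<mu> =
     measure_pmf (poisson_pmf (\<alpha> * real p)) \<Otimes>\<^sub>M
     PiM UNIV (\<lambda>_. B) \<Otimes>\<^sub>M
     PiM UNIV (\<lambda>_. F) \<Otimes>\<^sub>M
     PiM (UNIV \<times> {..<p - 1}) (\<lambda>_. F) \<Otimes>\<^sub>M
     PiM (UNIV \<times> {..<p - 1}) (\<lambda>_. \<mu>)"

definition cavity_magnetization ::
  "nat \<Rightarrow> real \<Rightarrow> real \<Rightarrow>
   nat \<times> (nat \<Rightarrow> real) \<times> (nat \<Rightarrow> real \<times> real) \<times> (nat \<times> nat \<Rightarrow> real \<times> real) \<times>
     (nat \<times> nat \<Rightarrow> real) \<Rightarrow> real" where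
  "cavity_magnetization p h \<beta> = (\<lambda>(N, bs, fs, fcs, ms).
     tanh ((\<Sum>k<N.
        let P = (\<Prod>i<p - 1. fst (fcs (k, i)) + ms (k, i) * snd (fcs (k, i)))
        in artanh (bs k * snd (fs k) * P / (1 + bs k * fst (fs k) * P))) + \<beta> * h))"

definition cavity_op ::
  "nat \<Rightarrow> real \<Rightarrow> real \<Rightarrow> real \<Rightarrow> real measure \<Rightarrow> (real \<times> real) measure \<Rightarrow> real measure \<Rightarrow> real measure"
  where
  "cavity_op p \<alpha> h \<beta> B F \<mu> =
     distr (cavity_space p \<alpha> B F \<mu>) interval_borel (cavity_magnetization p h \<beta>)"

definition cavity_fixed_point ::
  "nat \<Rightarrow> real \<Rightarrow> real \<Rightarrow> real \<Rightarrow> real measure \<Rightarrow> (real \<times> real) measure \<Rightarrow> real measure" where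
  "cavity_fixed_point p \<alpha> h \<beta> B F = (THE \<mu>. \<mu> \<in> Pr1 \<and> cavity_op p \<alpha> h \<beta> B F \<mu> = \<mu>)"

end

theory Submission
  imports Defs
begin

text \<open>
  The cavity operator describes one generation of a branching process: the root meets a Poisson
  number, of mean \<open>\<alpha> p\<close>, of interactions, and each of them brings \<open>p - 1\<close> new sites, whose
  magnetizations are drawn from the given measure. The mean number of offspring is
  \<open>\<alpha> p (p - 1) \<le> 1\<close>, and a site has no offspring with positive probability, so the tree is almost
  surely finite. On a finite tree the magnetization of the root is a function of the tree and of the
  finitely many disorder variables on it. Hence the iterates of the operator forget the measure put
  on the far generations, the only fixed point is the law of the root magnetization of the finite
  tree, and this law is atomic because finitely many atomic variables enter.

  The tree enters only through its extinction probabilities. The operator is extended to sub-probability measures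
  (\<open>sub_cavity_op\<close>), where missing mass stands for trees that are not yet extinct; on probability
  measures it is the cavity operator (\<open>cavity_op_eq_sub_cavity_op\<close>). The extension is monotone
  (\<open>sub_cavity_op_mono\<close>), because products of finite measures are. Its iterates from the zero measure
  (\<open>extinct_law\<close>) therefore increase, and their masses are the extinction probabilities of the
  branching process, which tend to \<open>1\<close> (\<open>extinction_iteration_tendsto_1\<close>). Their supremum
  (\<open>cavity_limit\<close>) is a probability measure.

  Existence and uniqueness then follow from monotonicity and one remark: a probability measure that
  lies below another one is equal to it. The image of the supremum lies above all iterates,
  hence above the supremum, hence is equal to it. Any fixed point lies above the zero measure, hence
  above all iterates, hence above the supremum, hence is equal to it.

  Each iterate is carried by a countable set: with \<open>N\<close> interactions the magnetization
  depends on finitely many arguments, each of which lies in a countable set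
  (\<open>countable_magnetization_values\<close>). So the supremum is carried by a countable set as well.
\<close>

section \<open>Measures on finite products\<close>

text \<open>
  Iterated integrals are monotone in every one of the measures, one coordinate at a time. This is
  what makes the cavity operator monotone.
\<close>
lemma PiM_mono_measure:
  assumes fin: "finite I"
    and sf: "\<And>i. sigma_finite_measure (M i)" "\<And>i. sigma_finite_measure (N i)"
    and sets: "\<And>i. sets (M i) = sets (N i)"
    and le: "\<And>i. M i \<le> N i"
  shows "PiM I M \<le> PiM I N"
proof -
  interpret M: product_sigma_finite M by (simp add: product_sigma_finite_def sf)
  interpret N: product_sigma_finite N by (simp add: product_sigma_finite_def sf)
  have sets_eq: "sets (PiM J M) = sets (PiM J N)" for J
    using sets by (intro sets_PiM_cong) auto
  have nn: "integral\<^sup>N (PiM I M) f \<le> integral\<^sup>N (PiM I N) f" if "f \<in> borel_measurable (PiM I N)" for f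
    using fin that
  proof (induction I arbitrary: f)
    case empty
    then show ?case by (simp add: M.nn_integral_empty N.nn_integral_empty)
  next
    case (insert i I)
    note [measurable] = insert.prems
    note [measurable_cong] = sets_eq sets
    have "f \<in> borel_measurable (PiM (insert i I) M)"
      by measurable
    then have "integral\<^sup>N (PiM (insert i I) M) f = (\<integral>\<^sup>+x. (\<integral>\<^sup>+y. f (x(i := y)) \<partial>M i) \<partial>PiM I M)"
      using insert.hyps by (intro M.product_nn_integral_insert)
    also have "\<dots> \<le> (\<integral>\<^sup>+x. (\<integral>\<^sup>+y. f (x(i := y)) \<partial>N i) \<partial>PiM I M)"
      by (intro nn_integral_mono nn_integral_mono_measure sets le)
    also have "\<dots> \<le> (\<integral>\<^sup>+x. (\<integral>\<^sup>+y. f (x(i := y)) \<partial>N i) \<partial>PiM I N)"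
    proof (rule insert.IH)
      interpret Ni: sigma_finite_measure "N i" by (rule sf)
      show "(\<lambda>x. \<integral>\<^sup>+y. f (x(i := y)) \<partial>N i) \<in> borel_measurable (PiM I N)"
        by measurable
    qed
    also have "\<dots> = integral\<^sup>N (PiM (insert i I) N) f"
      using insert.hyps insert.prems by (intro N.product_nn_integral_insert[symmetric])
    finally show ?case .
  qed
  show ?thesis
    unfolding le_measure[OF sets_eq]
  proof
    fix A assume A: "A \<in> sets (PiM I M)"
    with nn[of "indicator A"] show "emeasure (PiM I M) A \<le> emeasure (PiM I N) A"
      by (simp add: sets_eq)
  qed
qed

lemma emeasure_space_PiM_const:
  assumes "finite I" "sigma_finite_measure \<nu>"
  shows "emeasure (PiM I (\<lambda>_. \<nu>)) (space (PiM I (\<lambda>_. \<nu>))) = emeasure \<nu> (space \<nu>) ^ card I"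
proof -
  interpret product_sigma_finite "\<lambda>_. \<nu>" by (simp add: product_sigma_finite_def assms)
  show ?thesis using assms by (simp add: space_PiM emeasure_PiM)
qed

text \<open>
  In \<open>AE_PiM_component\<close> the factors have mass \<open>1\<close>. For other masses the exceptional set of one
  coordinate is still null when the product is finite, as the factors are \<open>\<sigma>\<close>-finite.
\<close>
lemma AE_PiM_all_components:
  assumes "finite I" "sigma_finite_measure \<nu>" and AE: "AE x in \<nu>. P x"
  shows "AE x in PiM I (\<lambda>_. \<nu>). \<forall>i\<in>I. P (x i)"
proof (rule AE_finite_allI[OF assms(1)])
  interpret product_sigma_finite "\<lambda>_. \<nu>" by (simp add: product_sigma_finite_def assms)
  fix i assume i: "i \<in> I"
  from AE obtain Z where Z: "Z \<in> null_sets \<nu>" "{x\<in>space \<nu>. \<not> P x} \<subseteq> Z"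
    by (auto simp: eventually_ae_filter)
  let ?Z = "PiE I (\<lambda>j. if j = i then Z else space \<nu>)"
  have "emeasure (PiM I (\<lambda>_. \<nu>)) ?Z = (\<Prod>j\<in>I. emeasure \<nu> (if j = i then Z else space \<nu>))"
    using Z by (intro emeasure_PiM assms) auto
  also have "\<dots> = 0"
    using i Z assms(1) by (auto intro!: prod_zero bexI[of _ i])
  finally have "?Z \<in> null_sets (PiM I (\<lambda>_. \<nu>))"
    using Z assms(1) by (auto intro!: null_setsI sets_PiM_I_finite)
  moreover have "{x\<in>space (PiM I (\<lambda>_. \<nu>)). \<not> P (x i)} \<subseteq> ?Z"
    using i Z by (auto simp: space_PiM PiE_iff extensional_def)
  ultimately show "AE x in PiM I (\<lambda>_. \<nu>). P (x i)"
    by (rule AE_I')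
qed

text \<open>
  Apart from the Poisson variable, the cavity space is a product of four factors paired to the
  right. Slicing off the first three leaves the law of the magnetizations alone in the innermost
  position, where measures on that component can be compared or exchanged.
\<close>
lemma emeasure_pair4:
  assumes "sigma_finite_measure N" "sigma_finite_measure P" "sigma_finite_measure Q"
    and X: "X \<in> sets (M \<Otimes>\<^sub>M N \<Otimes>\<^sub>M P \<Otimes>\<^sub>M Q)"
  shows "emeasure (M \<Otimes>\<^sub>M N \<Otimes>\<^sub>M P \<Otimes>\<^sub>M Q) X =
    (\<integral>\<^sup>+a. \<integral>\<^sup>+b. \<integral>\<^sup>+c. emeasure Q {d\<in>space Q. (a, b, c, d) \<in> X} \<partial>P \<partial>N \<partial>M)"
proof -
  interpret N: sigma_finite_measure N by fact
  interpret P: sigma_finite_measure P by fact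
  interpret Q: sigma_finite_measure Q by fact
  have PQ: "sigma_finite_measure (P \<Otimes>\<^sub>M Q)"
    and NPQ: "sigma_finite_measure (N \<Otimes>\<^sub>M P \<Otimes>\<^sub>M Q)"
    by (intro sigma_finite_pair_measure assms)+
  have X1: "Pair a -` X \<in> sets (N \<Otimes>\<^sub>M P \<Otimes>\<^sub>M Q)" for a
    using X by (rule sets_Pair1)
  have X2: "Pair b -` Pair a -` X \<in> sets (P \<Otimes>\<^sub>M Q)" for a b
    using X1 by (rule sets_Pair1)
  have X3: "Pair c -` Pair b -` Pair a -` X = {d\<in>space Q. (a, b, c, d) \<in> X}" for a b c
    using sets.sets_into_space[OF sets_Pair1[OF X2[where a=a and b=b], of c]] by auto
  show ?thesis
    by (simp add: sigma_finite_measure.emeasure_pair_measure_alt[OF NPQ X]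
        sigma_finite_measure.emeasure_pair_measure_alt[OF PQ X1]
        Q.emeasure_pair_measure_alt[OF X2] X3)
qed

text \<open>
  A strict inequality on some set would be reversed on its complement, as both measures have total
  mass \<open>1\<close>.
\<close>
lemma prob_space_eq_if_le:
  assumes "prob_space M" "prob_space N" "sets M = sets N" "M \<le> N"
  shows "M = N"
proof (rule measure_eqI)
  interpret M: prob_space M by fact
  interpret N: prob_space N by fact
  have le: "M.prob A \<le> N.prob A" if "A \<in> sets M" for A
    using assms(4) that le_measure[OF assms(3)]
    by (simp add: M.emeasure_eq_measure N.emeasure_eq_measure)
  have space: "space M = space N" by (rule sets_eq_imp_space_eq) fact
  fix A assume A: "A \<in> sets M"
  have "M.prob (space M - A) \<le> N.prob (space M - A)"
    using A by (intro le) auto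
  moreover have "M.prob (space M - A) = 1 - M.prob A" "N.prob (space M - A) = 1 - N.prob A"
    using M.prob_compl[of A] N.prob_compl[of A] A assms(3) space by simp_all
  ultimately have "N.prob A \<le> M.prob A" by simp
  with le[OF A] show "emeasure M A = emeasure N A"
    by (simp add: M.emeasure_eq_measure N.emeasure_eq_measure)
qed fact

lemma nn_integral_eq_0_if_AE:
  assumes "AE x in M. f x = 0"
  shows "integral\<^sup>N M f = 0"
  using nn_integral_cong_AE[OF assms] by simp

section \<open>Measures carried by countable sets\<close>

text \<open>The complement of the set of atoms is a Borel set on which every term of the sum vanishes.\<close>
lemma atomic_distr_imp_countable_AE:
  fixes X :: "'w \<Rightarrow> real"
  assumes X: "X \<in> borel_measurable M" and "atomic (distr M borel X)"
  shows "\<exists>S. countable S \<and> (AE \<omega> in M. X \<omega> \<in> S)"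
proof -
  from assms(2) obtain w x where
    wx: "\<And>A. A \<in> sets borel \<Longrightarrow>
      emeasure (distr M borel X) A = (\<Sum>n::nat. w n * emeasure (return (distr M borel X) (x n)) A)"
    unfolding atomic_def by auto
  have range: "range x \<in> sets borel"
    by (rule sets.countable[rotated]) auto
  then have meas: "- range x \<in> sets borel"
    by (rule borel_comp)
  have "emeasure (distr M borel X) (- range x) = 0"
    by (simp add: wx[OF meas] meas)
  then have "- range x \<in> null_sets (distr M borel X)"
    using meas by auto
  then have "AE y in distr M borel X. y \<in> range x"
    by (intro AE_I'[of "- range x"]) auto
  then have "AE \<omega> in M. X \<omega> \<in> range x"
    using AE_distr_iff[OF X, of "\<lambda>y. y \<in> range x"] range by simp
  then show ?thesis by (intro exI[of _ "range x"]) auto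
qed

text \<open>
  The weights are the masses of the points of the countable set. An enumeration of this set by
  \<^typ>\<open>nat\<close> repeats points when the set is finite, so only the indices in the range of
  \<open>to_nat_on\<close> get a weight; all others get weight \<open>0\<close> at an arbitrary point \<open>z\<close> of the space.
\<close>
lemma countable_carrier_imp_atomic:
  fixes S :: "'a set"
  assumes ne: "space \<mu> \<noteq> {}" and sing: "\<And>x. x \<in> space \<mu> \<Longrightarrow> {x} \<in> sets \<mu>"
    and S: "countable S" "AE x in \<mu>. x \<in> S"
  shows "atomic \<mu>"
proof -
  define T where "T = S \<inter> space \<mu>"
  have T: "countable T" "T \<subseteq> space \<mu>" "AE x in \<mu>. x \<in> T"
    using S by (auto simp: T_def)
  have T_sets: "B \<in> sets \<mu>" if "B \<subseteq> T" for B
    using T that by (intro sets.countable[OF sing] countable_subset[OF that]) auto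
  obtain z where z: "z \<in> space \<mu>" using ne by auto
  define x where "x n = (if n \<in> to_nat_on T ` T then from_nat_into T n else z)" for n
  define w where "w n = (if n \<in> to_nat_on T ` T then emeasure \<mu> {from_nat_into T n} else 0)" for n
  have inT: "from_nat_into T n \<in> T" if "n \<in> to_nat_on T ` T" for n
    using that T by auto
  show ?thesis unfolding atomic_def
  proof (intro exI conjI ballI)
    show "range x \<subseteq> space \<mu>" using z T inT by (auto simp: x_def)
    fix A assume A: "A \<in> sets \<mu>"
    define E where "E n = (if n \<in> to_nat_on T ` T then {from_nat_into T n} \<inter> A else {})" for n
    have E_T: "E n \<subseteq> T" for n using inT by (auto simp: E_def)
    have disj: "disjoint_family E"
      using T by (auto simp: disjoint_family_on_def E_def)
    have "w n * emeasure (return \<mu> (x n)) A = emeasure \<mu> (E n)" for n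
      using A inT[of n] by (auto simp: w_def x_def E_def indicator_def)
    moreover have "range E \<subseteq> sets \<mu>" using T_sets[OF E_T] by blast
    ultimately have "(\<Sum>n. w n * emeasure (return \<mu> (x n)) A) = emeasure \<mu> (\<Union>n. E n)"
      using suminf_emeasure[OF _ disj] by simp
    also have "(\<Union>n. E n) = A \<inter> T"
      using T by (force simp: E_def)
    also have "emeasure \<mu> (A \<inter> T) = emeasure \<mu> A"
      using T A T_sets by (intro emeasure_eq_AE) auto
    finally show "emeasure \<mu> A = (\<Sum>n. w n * emeasure (return \<mu> (x n)) A)" ..
  qed
qed

lemma AE_distr_countable:
  fixes X :: "'w \<Rightarrow> 'a::t1_space"
  assumes X: "X \<in> borel_measurable M" and S: "countable S" "AE \<omega> in M. X \<omega> \<in> S"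
  shows "AE x in distr M borel X. x \<in> S"
proof -
  have "S \<in> sets borel"
    by (rule sets.countable[OF _ S(1)]) auto
  then show ?thesis
    using AE_distr_iff[OF X, of "\<lambda>x. x \<in> S"] S(2) by simp
qed

section \<open>The extinction probability of the interaction tree\<close>

text \<open>
  The generating function of the Poisson law. It is used at \<open>x = q ^ m\<close>, where it is the
  probability that all offspring have a property which each of them has independently with
  probability \<open>q\<close>, if they come in a Poisson number of litters of size \<open>m\<close>.
\<close>
lemma nn_integral_poisson_power:
  assumes "r > 0" "x \<ge> 0"
  shows "(\<integral>\<^sup>+N. ennreal (x ^ N) \<partial>measure_pmf (poisson_pmf r)) = ennreal (exp (- r * (1 - x)))"
proof -
  have sums: "(\<lambda>N. exp (- r) * ((r * x) ^ N /\<^sub>R fact N)) sums (exp (- r) * exp (r * x))"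
    by (intro sums_mult exp_converges)
  have "(\<integral>\<^sup>+N. ennreal (x ^ N) \<partial>measure_pmf (poisson_pmf r)) =
      (\<Sum>N. ennreal (pmf (poisson_pmf r) N) * ennreal (x ^ N))"
    by (simp add: nn_integral_measure_pmf nn_integral_count_space_nat)
  also have "\<dots> = (\<Sum>N. ennreal (exp (- r) * ((r * x) ^ N /\<^sub>R fact N)))"
    using assms
    by (intro suminf_cong)
      (simp add: ennreal_mult'[symmetric] power_mult_distrib divide_inverse mult_ac)
  also have "\<dots> = ennreal (exp (- r) * exp (r * x))"
    using assms sums by (intro suminf_ennreal_eq) auto
  also have "exp (- r) * exp (r * x) = exp (- r * (1 - x))"
    by (simp add: exp_add[symmetric] algebra_simps)
  finally show ?thesis .
qed

text \<open>
  Here \<open>q\<close> is the extinction probability of a branching process in which every individual has a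
  Poisson number, of mean \<open>c\<close>, of litters of size \<open>m\<close>. If \<open>c m \<le> 1\<close>, then \<open>c (1 - q ^ m) \<le> 1 - q\<close> by
  Bernoulli's inequality, and \<open>exp (- y) > 1 - y\<close> for \<open>y \<noteq> 0\<close> excludes a solution below \<open>1\<close>. The
  strictness in the last step is what covers the critical case \<open>c m = 1\<close>.
\<close>
lemma extinction_fixed_point_eq_1:
  fixes q c :: real
  assumes q: "0 \<le> q" "q \<le> 1" and "c \<ge> 0" "c * real m \<le> 1"
    and fp: "q = exp (- c * (1 - q ^ m))"
  shows "q = 1"
proof (rule ccontr)
  assume "q \<noteq> 1"
  then have "q < 1" using q by simp
  define y where "y = c * (1 - q ^ m)"
  have "1 + real m * (q - 1) \<le> (1 + (q - 1)) ^ m"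
    using q by (intro Bernoulli_inequality) auto
  then have "1 - q ^ m \<le> real m * (1 - q)"
    by (simp add: algebra_simps)
  then have "y \<le> c * real m * (1 - q)"
    using mult_left_mono[OF _ \<open>c \<ge> 0\<close>] by (simp add: y_def mult.assoc)
  also have "\<dots> \<le> 1 - q"
    using mult_right_mono[OF assms(4), of "1 - q"] q by simp
  finally have y: "y \<le> 1 - q" .
  have "y \<noteq> 0" using fp \<open>q < 1\<close> by (auto simp: y_def)
  then have "1 - y < exp (- y)"
    using exp_minus_greater[of y] by simp
  then show False using fp y by (simp add: y_def)
qed

lemma extinction_iteration_tendsto_1:
  fixes q :: "nat \<Rightarrow> real"
  assumes inc: "incseq q" and q: "\<And>n. 0 \<le> q n" "\<And>n. q n \<le> 1" and "c \<ge> 0" "c * real m \<le> 1"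
    and rec: "\<And>n. q (Suc n) = exp (- c * (1 - q n ^ m))"
  shows "q \<longlonglongrightarrow> 1"
proof -
  obtain L where L: "q \<longlonglongrightarrow> L" "\<And>n. q n \<le> L"
    using incseq_convergent[OF inc, of 1] q by auto
  have "(\<lambda>n. q (Suc n)) \<longlonglongrightarrow> exp (- c * (1 - L ^ m))"
    unfolding rec by (intro tendsto_intros L)
  moreover have "(\<lambda>n. q (Suc n)) \<longlonglongrightarrow> L" by (rule LIMSEQ_Suc[OF L(1)])
  ultimately have "L = exp (- c * (1 - L ^ m))" by (rule LIMSEQ_unique[rotated])
  moreover have "0 \<le> L" "L \<le> 1"
    using L q by (auto intro: order_trans LIMSEQ_le_const2)
  ultimately have "L = 1" using assms(4,5) by (intro extinction_fixed_point_eq_1)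
  with L show ?thesis by simp
qed

section \<open>Measurability of the magnetization\<close>

lemma space_interval_borel [simp]: "space interval_borel = {-1..1}"
  by (simp add: interval_borel_def space_restrict_space)

lemma countable_sets_interval_borel:
  assumes "countable S" "S \<subseteq> {-1..1}"
  shows "S \<in> sets interval_borel"
proof -
  have "S \<in> sets borel" by (rule sets.countable) (use assms in auto)
  with assms show ?thesis by (auto simp: interval_borel_def sets_restrict_space_iff)
qed

lemma borel_measurable_artanh [measurable]: "(artanh :: real \<Rightarrow> real) \<in> borel_measurable borel"
  unfolding artanh_def by measurable

lemma borel_measurable_tanh [measurable]: "(tanh :: real \<Rightarrow> real) \<in> borel_measurable borel"
  by (intro borel_measurable_continuous_onI continuous_intros) (auto simp: cosh_real_pos less_imp_neq[symmetric])

lemma tanh_real_in_interval: "tanh (x :: real) \<in> {-1..1}"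
  using tanh_real_bounds[of x] by auto

lemma measurable_ident_interval_borel [measurable]: "(\<lambda>x. x) \<in> measurable interval_borel borel"
  unfolding interval_borel_def by (intro measurable_restrict_space1) simp

locale cavity_model =
  fixes p :: nat and \<alpha> h \<beta> :: real and B :: "real measure" and F :: "(real \<times> real) measure"
  assumes p_ge_2: "p \<ge> 2" and \<alpha>_pos: "\<alpha> > 0"
    and prob_B: "prob_space B" and sets_B: "sets B = sets borel"
    and prob_F: "prob_space F" and sets_F: "sets F = sets borel"
begin

text \<open>The indices of the cavity magnetizations that matter when there are \<open>N\<close> interactions.\<close>
abbreviation "cavities N \<equiv> {..<N} \<times> {..<p - 1}"

text \<open>
  The cavity space without its Poisson component, and with any index set for the cavity
  magnetizations. A finite index set gives a product that makes sense for sub-probability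
  measures \<open>\<nu>\<close>.
\<close>
definition cavity_sample where
  "cavity_sample J \<nu> =
     PiM UNIV (\<lambda>_::nat. B) \<Otimes>\<^sub>M PiM UNIV (\<lambda>_::nat. F) \<Otimes>\<^sub>M PiM (UNIV \<times> {..<p - 1}) (\<lambda>_. F) \<Otimes>\<^sub>M
     PiM J (\<lambda>_. \<nu>)"

text \<open>
  The index set depends on \<open>N\<close>: only the magnetizations that enter count, so that the total mass
  of the kernel is the \<open>N (p - 1)\<close>-th power of the mass of \<open>\<nu>\<close>.
\<close>
definition cavity_kernel where
  "cavity_kernel \<nu> N =
     distr (cavity_sample (cavities N) \<nu>) interval_borel (\<lambda>r. cavity_magnetization p h \<beta> (N, r))"

definition sub_cavity_op where
  "sub_cavity_op \<nu> = measure_pmf (poisson_pmf (\<alpha> * real p)) \<bind> cavity_kernel \<nu>"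

lemma measurable_magnetization:
  assumes "sets \<nu> = sets interval_borel" "cavities N \<subseteq> J"
  shows "(\<lambda>r. cavity_magnetization p h \<beta> (N, r)) \<in> measurable (cavity_sample J \<nu>) interval_borel"
proof -
  note [measurable_cong] = sets_B sets_F assms(1)
  have fst_F: "fst \<in> borel_measurable F" and snd_F: "snd \<in> borel_measurable F"
    unfolding measurable_cong_sets[OF sets_F refl]
    by (intro borel_measurable_continuous_onI continuous_intros)+
  have id: "(\<lambda>x. x) \<in> borel_measurable \<nu>"
    using measurable_ident_interval_borel by (simp add: measurable_cong_sets[OF assms(1) refl])
  have J: "k < N \<Longrightarrow> i < p - 1 \<Longrightarrow> (k, i) \<in> J" for k i using assms(2) by auto
  let ?S = "PiM UNIV (\<lambda>_::nat. B) \<Otimes>\<^sub>M PiM UNIV (\<lambda>_::nat. F) \<Otimes>\<^sub>M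
    PiM (UNIV \<times> {..<p - 1}) (\<lambda>_. F) \<Otimes>\<^sub>M PiM J (\<lambda>_. \<nu>)"
  have b: "(\<lambda>x. fst x k) \<in> borel_measurable ?S" for k
    by measurable
  have f: "(\<lambda>x. fst (snd x) k) \<in> measurable ?S F" for k
    by measurable
  have fc: "(\<lambda>x. fst (snd (snd x)) (k, i)) \<in> measurable ?S F" if "i < p - 1" for k i
  proof -
    from that have [measurable]: "(k, i) \<in> UNIV \<times> {..<p - 1}" by auto
    show ?thesis by measurable
  qed
  have m: "(\<lambda>x. snd (snd (snd x)) (k, i)) \<in> measurable ?S \<nu>" if "k < N" "i < p - 1" for k i
  proof -
    from that have [measurable]: "(k, i) \<in> J" by (rule J)
    show ?thesis by measurable
  qed
  have P: "(\<lambda>x. \<Prod>i<p - 1. fst (fst (snd (snd x)) (k, i)) +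
      snd (snd (snd x)) (k, i) * snd (fst (snd (snd x)) (k, i))) \<in> borel_measurable ?S"
    if "k < N" for k
    using that
    by (intro borel_measurable_prod borel_measurable_add borel_measurable_times
        measurable_compose[OF fc fst_F] measurable_compose[OF fc snd_F] measurable_compose[OF m id])
      auto
  have "(\<lambda>r. cavity_magnetization p h \<beta> (N, r)) \<in> borel_measurable ?S"
    unfolding cavity_magnetization_def Let_def case_prod_beta' fst_conv snd_conv
    by (intro borel_measurable_add borel_measurable_sum borel_measurable_const
        measurable_compose[OF _ borel_measurable_tanh] measurable_compose[OF _ borel_measurable_artanh]
        borel_measurable_divide borel_measurable_times P b
        measurable_compose[OF f fst_F] measurable_compose[OF f snd_F]) auto
  then show ?thesis
    unfolding interval_borel_def cavity_sample_def
    by (intro measurable_restrict_space2) (auto simp: cavity_magnetization_def tanh_real_in_interval[simplified] split: prod.splits)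
qed

lemma prob_PiM_B: "prob_space (PiM UNIV (\<lambda>_::nat. B))"
  and prob_PiM_F: "prob_space (PiM J (\<lambda>_. F))"
  by (intro prob_space_PiM prob_B prob_F)+

lemma prob_space_cavity_sample:
  assumes "prob_space \<nu>"
  shows "prob_space (cavity_sample J \<nu>)"
  unfolding cavity_sample_def
  by (intro prob_space_pair prob_space_PiM prob_B prob_F assms)

lemma magnetization_in_interval: "cavity_magnetization p h \<beta> r \<in> {-1..1}"
  using tanh_real_in_interval by (auto simp: cavity_magnetization_def split: prod.splits)

text \<open>
  The index set \<open>J\<close> is general so that the formula covers both the finite products of
  \<open>cavity_kernel\<close> and the infinite product of the cavity space.
\<close>
lemma emeasure_magnetization_law:
  assumes "sets \<nu> = sets interval_borel" "cavities N \<subseteq> J" "sigma_finite_measure (PiM J (\<lambda>_. \<nu>))"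
    and A: "A \<in> sets interval_borel"
  shows "emeasure (distr (cavity_sample J \<nu>) interval_borel
      (\<lambda>r. cavity_magnetization p h \<beta> (N, r))) A =
    (\<integral>\<^sup>+bs. \<integral>\<^sup>+fs. \<integral>\<^sup>+fcs. emeasure (PiM J (\<lambda>_. \<nu>))
        {ms\<in>space (PiM J (\<lambda>_. \<nu>)). cavity_magnetization p h \<beta> (N, bs, fs, fcs, ms) \<in> A}
      \<partial>PiM (UNIV \<times> {..<p - 1}) (\<lambda>_. F) \<partial>PiM UNIV (\<lambda>_. F) \<partial>PiM UNIV (\<lambda>_. B))"
proof -
  let ?X = "(\<lambda>r. cavity_magnetization p h \<beta> (N, r)) -` A \<inter> space (cavity_sample J \<nu>)"
  note meas = measurable_magnetization[OF assms(1,2)]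
  have X: "?X \<in> sets (cavity_sample J \<nu>)"
    using meas A by (rule measurable_sets)
  have "emeasure (cavity_sample J \<nu>) ?X =
    (\<integral>\<^sup>+bs. \<integral>\<^sup>+fs. \<integral>\<^sup>+fcs. emeasure (PiM J (\<lambda>_. \<nu>))
        {ms\<in>space (PiM J (\<lambda>_. \<nu>)). (bs, fs, fcs, ms) \<in> ?X}
      \<partial>PiM (UNIV \<times> {..<p - 1}) (\<lambda>_. F) \<partial>PiM UNIV (\<lambda>_. F) \<partial>PiM UNIV (\<lambda>_. B))"
    using X unfolding cavity_sample_def
    by (intro emeasure_pair4 assms prob_space_imp_sigma_finite prob_PiM_F)
  also have "\<dots> = (\<integral>\<^sup>+bs. \<integral>\<^sup>+fs. \<integral>\<^sup>+fcs. emeasure (PiM J (\<lambda>_. \<nu>))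
        {ms\<in>space (PiM J (\<lambda>_. \<nu>)). cavity_magnetization p h \<beta> (N, bs, fs, fcs, ms) \<in> A}
      \<partial>PiM (UNIV \<times> {..<p - 1}) (\<lambda>_. F) \<partial>PiM UNIV (\<lambda>_. F) \<partial>PiM UNIV (\<lambda>_. B))"
    by (intro nn_integral_cong arg_cong[where f="emeasure _"])
      (auto simp: cavity_sample_def space_pair_measure)
  finally show ?thesis
    using meas A by (simp add: emeasure_distr)
qed

section \<open>The cavity operator on sub-probability measures\<close>

lemma sets_cavity_kernel [simp]: "sets (cavity_kernel \<nu> N) = sets interval_borel"
  and space_cavity_kernel [simp]: "space (cavity_kernel \<nu> N) = {-1..1}"
  by (simp_all add: cavity_kernel_def)

lemma emeasure_cavity_kernel:
  assumes "sets \<nu> = sets interval_borel" "subprob_space \<nu>" "A \<in> sets interval_borel"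
  shows "emeasure (cavity_kernel \<nu> N) A =
    (\<integral>\<^sup>+bs. \<integral>\<^sup>+fs. \<integral>\<^sup>+fcs. emeasure (PiM (cavities N) (\<lambda>_. \<nu>))
        {ms\<in>space (PiM (cavities N) (\<lambda>_. \<nu>)). cavity_magnetization p h \<beta> (N, bs, fs, fcs, ms) \<in> A}
      \<partial>PiM (UNIV \<times> {..<p - 1}) (\<lambda>_. F) \<partial>PiM UNIV (\<lambda>_. F) \<partial>PiM UNIV (\<lambda>_. B))"
proof -
  interpret subprob_space \<nu> by fact
  interpret product_sigma_finite "\<lambda>_. \<nu>" by (simp add: product_sigma_finite_def sigma_finite_measure_axioms)
  show ?thesis unfolding cavity_kernel_def
    by (intro emeasure_magnetization_law assms sigma_finite order.refl) auto
qed

text \<open>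
  Every magnetization lies in the interval, and the disorder factors are probability measures, so
  the mass is that of the product of the copies of \<open>\<nu>\<close>.
\<close>
lemma cavity_kernel_mass:
  assumes "sets \<nu> = sets interval_borel" "subprob_space \<nu>"
  shows "emeasure (cavity_kernel \<nu> N) {-1..1} = emeasure \<nu> {-1..1} ^ (N * (p - 1))"
proof -
  interpret subprob_space \<nu> by fact
  interpret Bs: prob_space "PiM UNIV (\<lambda>_::nat. B)" by (rule prob_PiM_B)
  interpret Fs: prob_space "PiM J (\<lambda>_. F)" for J :: "'x set" by (rule prob_PiM_F)
  have top: "{-1..1} \<in> sets interval_borel"
    using sets.top[of interval_borel] by simp
  have space: "space \<nu> = {-1..1}"
    using sets_eq_imp_space_eq[OF assms(1)] by simp
  show ?thesis
    unfolding emeasure_cavity_kernel[OF assms top]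
    using emeasure_space_PiM_const[of "cavities N" \<nu>] sigma_finite_measure_axioms
    by (simp add: magnetization_in_interval[simplified] Bs.emeasure_space_1 Fs.emeasure_space_1 space)
qed

lemma cavity_kernel_mono:
  assumes "sets \<nu> = sets interval_borel" "subprob_space \<nu>"
    and "sets \<mu> = sets interval_borel" "subprob_space \<mu>" and "\<nu> \<le> \<mu>"
    and A: "A \<in> sets interval_borel"
  shows "emeasure (cavity_kernel \<nu> N) A \<le> emeasure (cavity_kernel \<mu> N) A"
proof -
  interpret \<nu>: subprob_space \<nu> by fact
  interpret \<mu>: subprob_space \<mu> by fact
  have sets: "sets (PiM (cavities N) (\<lambda>_. \<nu>)) = sets (PiM (cavities N) (\<lambda>_. \<mu>))"
    using assms by (intro sets_PiM_cong) auto
  have le: "PiM (cavities N) (\<lambda>_. \<nu>) \<le> PiM (cavities N) (\<lambda>_. \<mu>)"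
    using assms by (intro PiM_mono_measure) (auto intro: \<nu>.sigma_finite_measure_axioms \<mu>.sigma_finite_measure_axioms)
  have space: "space (PiM (cavities N) (\<lambda>_. \<nu>)) = space (PiM (cavities N) (\<lambda>_. \<mu>))"
    by (rule sets_eq_imp_space_eq[OF sets])
  have "emeasure (PiM (cavities N) (\<lambda>_. \<nu>)) X \<le> emeasure (PiM (cavities N) (\<lambda>_. \<mu>)) X" for X
    using le sets by (cases "X \<in> sets (PiM (cavities N) (\<lambda>_. \<nu>))")
      (auto simp: le_measure emeasure_notin_sets)
  then show ?thesis
    unfolding emeasure_cavity_kernel[OF assms(1,2) A] emeasure_cavity_kernel[OF assms(3,4) A] space
    by (intro nn_integral_mono)
qed

lemma cavity_kernel_in_subprob:
  assumes "sets \<nu> = sets interval_borel" "subprob_space \<nu>"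
  shows "cavity_kernel \<nu> \<in> measurable (measure_pmf q) (subprob_algebra interval_borel)"
proof -
  have "subprob_space (cavity_kernel \<nu> N)" for N
  proof
    have "emeasure \<nu> {-1..1} \<le> 1" by (rule subprob_space.subprob_emeasure_le_1[OF assms(2)])
    then have "emeasure \<nu> {-1..1} ^ n \<le> 1" for n
      using mult_mono[of "emeasure \<nu> {-1..1}" 1] by (induction n) auto
    then show "emeasure (cavity_kernel \<nu> N) (space (cavity_kernel \<nu> N)) \<le> 1"
      by (simp add: cavity_kernel_mass[OF assms])
  qed simp
  then show ?thesis by (simp add: space_subprob_algebra)
qed

lemma sets_sub_cavity_op [simp]: "sets (sub_cavity_op \<nu>) = sets interval_borel"
  unfolding sub_cavity_op_def by (rule sets_bind) auto

lemma space_sub_cavity_op [simp]: "space (sub_cavity_op \<nu>) = {-1..1}"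
  using sets_eq_imp_space_eq[OF sets_sub_cavity_op] by simp

lemma emeasure_sub_cavity_op:
  assumes "sets \<nu> = sets interval_borel" "subprob_space \<nu>" "A \<in> sets interval_borel"
  shows "emeasure (sub_cavity_op \<nu>) A =
    (\<integral>\<^sup>+N. emeasure (cavity_kernel \<nu> N) A \<partial>measure_pmf (poisson_pmf (\<alpha> * real p)))"
  unfolding sub_cavity_op_def
  by (rule emeasure_bind[OF _ cavity_kernel_in_subprob[OF assms(1,2)] assms(3)]) simp

lemma subprob_space_sub_cavity_op:
  assumes "sets \<nu> = sets interval_borel" "subprob_space \<nu>"
  shows "subprob_space (sub_cavity_op \<nu>)"
  unfolding sub_cavity_op_def
  by (rule subprob_space_bind[OF _ cavity_kernel_in_subprob[OF assms]])
    (intro prob_space_imp_subprob_space measure_pmf.prob_space_axioms)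

lemma sub_cavity_op_mono:
  assumes "sets \<nu> = sets interval_borel" "subprob_space \<nu>"
    and "sets \<mu> = sets interval_borel" "subprob_space \<mu>" and "\<nu> \<le> \<mu>"
  shows "sub_cavity_op \<nu> \<le> sub_cavity_op \<mu>"
  using assms
  by (subst le_measure)
    (auto simp: emeasure_sub_cavity_op intro!: nn_integral_mono cavity_kernel_mono)

text \<open>
  The magnetization with \<open>N\<close> interactions does not see the coordinates outside \<open>cavities N\<close>, and for a
  probability measure the restriction of the infinite product to finitely many coordinates is the
  finite product.
\<close>
lemma cavity_kernel_eq_law:
  assumes "sets \<nu> = sets interval_borel" "prob_space \<nu>"
  shows "distr (cavity_sample (UNIV \<times> {..<p - 1}) \<nu>) interval_borel
    (\<lambda>r. cavity_magnetization p h \<beta> (N, r)) = cavity_kernel \<nu> N"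
proof (rule measure_eqI)
  let ?I = "UNIV \<times> {..<p - 1} :: (nat \<times> nat) set"
  let ?\<nu> = "PiM (cavities N) (\<lambda>_. \<nu>)"
  fix A assume "A \<in> sets (distr (cavity_sample ?I \<nu>) interval_borel
    (\<lambda>r. cavity_magnetization p h \<beta> (N, r)))"
  then have A: "A \<in> sets interval_borel" by simp
  have restr: "distr (PiM ?I (\<lambda>_. \<nu>)) ?\<nu> (\<lambda>ms. restrict ms (cavities N)) = ?\<nu>"
    using distr_PiM_reindex[of ?I "\<lambda>_. \<nu>" "\<lambda>x. x" "cavities N"] assms
    by (auto simp: restrict_def)
  have mag: "cavity_magnetization p h \<beta> (N, bs, fs, fcs, restrict ms (cavities N)) =
      cavity_magnetization p h \<beta> (N, bs, fs, fcs, ms)" for bs fs fcs ms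
    by (simp add: cavity_magnetization_def Let_def)
  have eq: "emeasure (PiM ?I (\<lambda>_. \<nu>))
      {ms\<in>space (PiM ?I (\<lambda>_. \<nu>)). cavity_magnetization p h \<beta> (N, bs, fs, fcs, ms) \<in> A} =
    emeasure ?\<nu> {ms\<in>space ?\<nu>. cavity_magnetization p h \<beta> (N, bs, fs, fcs, ms) \<in> A}"
    if "bs \<in> space (PiM UNIV (\<lambda>_. B))" "fs \<in> space (PiM UNIV (\<lambda>_. F))"
      "fcs \<in> space (PiM ?I (\<lambda>_. F))" for bs fs fcs
  proof -
    have meas: "(\<lambda>ms. cavity_magnetization p h \<beta> (N, bs, fs, fcs, ms)) \<in> measurable ?\<nu> interval_borel"
      using measurable_Pair2[OF measurable_Pair2[OF measurable_Pair2[OF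
          measurable_magnetization[OF assms(1) order.refl, of N, unfolded cavity_sample_def]
          that(1)] that(2)] that(3)] .
    have "{ms\<in>space ?\<nu>. cavity_magnetization p h \<beta> (N, bs, fs, fcs, ms) \<in> A} \<in> sets ?\<nu>"
      using measurable_sets[OF meas A] by (simp add: vimage_def Int_def conj_commute)
    moreover have "(\<lambda>ms. restrict ms (cavities N)) \<in> measurable (PiM ?I (\<lambda>_. \<nu>)) ?\<nu>"
      by (intro measurable_restrict_subset) auto
    ultimately show ?thesis
      by (subst restr[symmetric])
        (auto simp: emeasure_distr mag[simplified] intro!: arg_cong[where f="emeasure _"] simp: space_PiM)
  qed
  show "emeasure (distr (cavity_sample ?I \<nu>) interval_borel
      (\<lambda>r. cavity_magnetization p h \<beta> (N, r))) A = emeasure (cavity_kernel \<nu> N) A"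
    unfolding emeasure_cavity_kernel[OF assms(1) prob_space_imp_subprob_space[OF assms(2)] A]
    by (subst emeasure_magnetization_law)
      (auto intro!: A assms prob_space_imp_sigma_finite prob_space_PiM nn_integral_cong eq[simplified])
qed simp

text \<open>Conditioning on the Poisson variable, which is discrete.\<close>
lemma cavity_op_eq_sub_cavity_op:
  assumes "\<nu> \<in> Pr1"
  shows "cavity_op p \<alpha> h \<beta> B F \<nu> = sub_cavity_op \<nu>"
proof (rule measure_eqI)
  from assms have \<nu>: "sets \<nu> = sets interval_borel" "prob_space \<nu>" by (auto simp: Pr1_def)
  let ?S = "cavity_sample (UNIV \<times> {..<p - 1}) \<nu>"
  let ?pois = "measure_pmf (poisson_pmf (\<alpha> * real p))"
  have space: "cavity_space p \<alpha> B F \<nu> = ?pois \<Otimes>\<^sub>M ?S"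
    by (simp add: cavity_space_def cavity_sample_def)
  have meas: "cavity_magnetization p h \<beta> \<in> measurable (?pois \<Otimes>\<^sub>M ?S) interval_borel"
  proof -
    have "cavity_magnetization p h \<beta> \<in> measurable (count_space UNIV \<Otimes>\<^sub>M ?S) interval_borel"
      by (intro measurable_pair_measure_countable1 measurable_magnetization \<nu>) auto
    moreover have "sets (?pois \<Otimes>\<^sub>M ?S) = sets (count_space UNIV \<Otimes>\<^sub>M ?S)"
      by (intro sets_pair_measure_cong) auto
    ultimately show ?thesis by (simp cong: measurable_cong_sets)
  qed
  interpret S: prob_space ?S by (rule prob_space_cavity_sample) fact
  fix A assume "A \<in> sets (cavity_op p \<alpha> h \<beta> B F \<nu>)"
  then have A: "A \<in> sets interval_borel" by (simp add: cavity_op_def)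
  let ?X = "cavity_magnetization p h \<beta> -` A \<inter> space (?pois \<Otimes>\<^sub>M ?S)"
  have "emeasure (cavity_op p \<alpha> h \<beta> B F \<nu>) A = emeasure (?pois \<Otimes>\<^sub>M ?S) ?X"
    using meas A by (simp add: cavity_op_def space emeasure_distr)
  also have "\<dots> = (\<integral>\<^sup>+N. emeasure ?S (Pair N -` ?X) \<partial>?pois)"
    by (rule S.emeasure_pair_measure_alt[OF measurable_sets[OF meas A]])
  also have "\<dots> = (\<integral>\<^sup>+N. emeasure (cavity_kernel \<nu> N) A \<partial>?pois)"
  proof (rule nn_integral_cong)
    fix N
    have "emeasure ?S (Pair N -` ?X) = emeasure (distr ?S interval_borel
        (\<lambda>r. cavity_magnetization p h \<beta> (N, r))) A"
      by (subst emeasure_distr[OF measurable_magnetization A])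
        (auto simp: \<nu> space_pair_measure intro!: arg_cong[where f="emeasure _"])
    then show "emeasure ?S (Pair N -` ?X) = emeasure (cavity_kernel \<nu> N) A"
      by (simp only: cavity_kernel_eq_law[OF \<nu>])
  qed
  also have "\<dots> = emeasure (sub_cavity_op \<nu>) A"
    using \<nu> A by (simp add: emeasure_sub_cavity_op prob_space_imp_subprob_space)
  finally show "emeasure (cavity_op p \<alpha> h \<beta> B F \<nu>) A = emeasure (sub_cavity_op \<nu>) A" .
qed (simp add: cavity_op_def)

section \<open>Countable sets carrying the laws\<close>

text \<open>
  Only the arguments that enter the magnetization with \<open>N\<close> interactions are constrained, so that
  membership holds almost surely whenever the coordinate laws are carried by the given sets.
\<close>
definition magnetization_values where
  "magnetization_values N SB SF S = {cavity_magnetization p h \<beta> (N, bs, fs, fcs, ms) | bs fs fcs ms.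
    (\<forall>k<N. bs k \<in> SB) \<and> (\<forall>k<N. fs k \<in> SF) \<and> (\<forall>j\<in>cavities N. fcs j \<in> SF) \<and> (\<forall>j\<in>cavities N. ms j \<in> S)}"

lemma magnetization_valuesI:
  assumes "\<forall>k<N. bs k \<in> SB" "\<forall>k<N. fs k \<in> SF" "\<forall>j\<in>cavities N. fcs j \<in> SF" "\<forall>j\<in>cavities N. ms j \<in> S"
  shows "cavity_magnetization p h \<beta> (N, bs, fs, fcs, ms) \<in> magnetization_values N SB SF S"
  unfolding magnetization_values_def
  by (rule CollectI, intro exI conjI, rule refl) (fact assms)+

text \<open>
  The values are already attained on arguments restricted to the finitely many indices that enter,
  and finite products of countable sets are countable.
\<close>
lemma countable_magnetization_values:
  assumes "countable SB" "countable SF" "countable S"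
  shows "countable (magnetization_values N SB SF S)"
proof -
  let ?E = "PiE {..<N} (\<lambda>_. SB) \<times> PiE {..<N} (\<lambda>_. SF) \<times> PiE (cavities N) (\<lambda>_. SF) \<times>
    PiE (cavities N) (\<lambda>_. S)"
  have "magnetization_values N SB SF S \<subseteq> (\<lambda>r. cavity_magnetization p h \<beta> (N, r)) ` ?E"
  proof
    fix x assume "x \<in> magnetization_values N SB SF S"
    then obtain bs fs fcs ms where x: "x = cavity_magnetization p h \<beta> (N, bs, fs, fcs, ms)"
      and mem: "\<forall>k<N. bs k \<in> SB" "\<forall>k<N. fs k \<in> SF"
        "\<forall>j\<in>cavities N. fcs j \<in> SF" "\<forall>j\<in>cavities N. ms j \<in> S"
      unfolding magnetization_values_def by blast
    show "x \<in> (\<lambda>r. cavity_magnetization p h \<beta> (N, r)) ` ?E"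
    proof (rule image_eqI)
      show "x = cavity_magnetization p h \<beta> (N, restrict bs {..<N}, restrict fs {..<N},
          restrict fcs (cavities N), restrict ms (cavities N))"
        unfolding x by (simp add: cavity_magnetization_def Let_def)
      show "(restrict bs {..<N}, restrict fs {..<N}, restrict fcs (cavities N),
          restrict ms (cavities N)) \<in> ?E"
        using mem by auto
    qed
  qed
  moreover have "countable ?E"
    using assms by (intro countable_SIGMA countable_PiE) auto
  ultimately show ?thesis by (rule countable_subset[OF _ countable_image])
qed

text \<open>
  Almost surely every coordinate lies in the countable set that carries its law, and then the
  magnetization lies in the countable union over \<open>N\<close> of the sets \<open>magnetization_values\<close>.
\<close>
lemma sub_cavity_op_countable_carrier:
  assumes SB: "countable SB" "AE x in B. x \<in> SB" and SF: "countable SF" "AE x in F. x \<in> SF"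
    and \<nu>: "sets \<nu> = sets interval_borel" "subprob_space \<nu>"
    and S: "countable S" "AE x in \<nu>. x \<in> S"
  shows "\<exists>S'. countable S' \<and> (AE x in sub_cavity_op \<nu>. x \<in> S')"
proof -
  interpret subprob_space \<nu> by fact
  let ?S' = "\<Union>N. magnetization_values N SB SF S"
  let ?A = "{-1..1} - ?S'"
  have countable: "countable ?S'"
    using SB SF S by (intro countable_UN countable_magnetization_values) auto
  have "?S' \<subseteq> {-1..1}"
    using magnetization_in_interval by (auto simp: magnetization_values_def)
  then have "?S' \<in> sets interval_borel"
    by (rule countable_sets_interval_borel[OF countable])
  then have A: "?A \<in> sets interval_borel"
    using sets.compl_sets[of ?S' interval_borel] by simp
  have AE_B: "AE bs in PiM UNIV (\<lambda>_::nat. B). \<forall>k<N. bs k \<in> SB" for N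
    using SB by (auto simp: AE_all_countable intro: prob_B AE_PiM_component)
  have AE_F: "AE fs in PiM J (\<lambda>_. F). \<forall>k\<in>I. fs k \<in> SF" if "I \<subseteq> J" "countable I" for I J :: "'x set"
    using that SF by (subst AE_ball_countable) (auto intro!: prob_F AE_PiM_component)
  have zero: "emeasure (cavity_kernel \<nu> N) ?A = 0" for N
  proof -
    have ms: "emeasure (PiM (cavities N) (\<lambda>_. \<nu>)) {ms\<in>space (PiM (cavities N) (\<lambda>_. \<nu>)).
        cavity_magnetization p h \<beta> (N, bs, fs, fcs, ms) \<in> ?A} = 0"
      if "\<forall>k<N. bs k \<in> SB" "\<forall>k<N. fs k \<in> SF" "\<forall>j\<in>cavities N. fcs j \<in> SF" for bs fs fcs
    proof -
      have "AE ms in PiM (cavities N) (\<lambda>_. \<nu>). \<forall>j\<in>cavities N. ms j \<in> S"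
        using S by (intro AE_PiM_all_components sigma_finite_measure_axioms) auto
      then have "AE ms in PiM (cavities N) (\<lambda>_. \<nu>).
          cavity_magnetization p h \<beta> (N, bs, fs, fcs, ms) \<notin> ?A"
        by (rule eventually_mono) (use magnetization_valuesI[OF that] in blast)
      then show ?thesis by (rule emeasure_eq_0_AE)
    qed
    show ?thesis
      unfolding emeasure_cavity_kernel[OF \<nu> A]
    proof (rule nn_integral_eq_0_if_AE, rule eventually_mono[OF AE_B[of N]],
        rule nn_integral_eq_0_if_AE, rule eventually_mono[OF AE_F[of "{..<N}" UNIV]])
      fix bs fs assume bs: "\<forall>k<N. bs k \<in> SB" and fs: "\<forall>k\<in>{..<N}. fs k \<in> SF"
      have "AE fcs in PiM (UNIV \<times> {..<p - 1}) (\<lambda>_. F). \<forall>j\<in>cavities N. fcs j \<in> SF"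
        by (rule AE_F) auto
      then show "(\<integral>\<^sup>+fcs. emeasure (PiM (cavities N) (\<lambda>_. \<nu>))
          {ms\<in>space (PiM (cavities N) (\<lambda>_. \<nu>)). cavity_magnetization p h \<beta> (N, bs, fs, fcs, ms) \<in> ?A}
          \<partial>PiM (UNIV \<times> {..<p - 1}) (\<lambda>_. F)) = 0"
        by (intro nn_integral_eq_0_if_AE) (rule eventually_mono, assumption, rule ms,
          use bs fs in simp_all)
    qed auto
  qed
  have "emeasure (sub_cavity_op \<nu>) ?A = 0"
    using A \<nu> by (simp add: emeasure_sub_cavity_op zero)
  then have "?A \<in> null_sets (sub_cavity_op \<nu>)" using A by auto
  then have "AE x in sub_cavity_op \<nu>. x \<in> ?S'"
    by (rule AE_I') auto
  with countable show ?thesis by blast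
qed

section \<open>Laws on the event of early extinction\<close>

text \<open>
  The law of the magnetization of the root, restricted to the event that the interaction tree has no
  site at distance \<open>n\<close> from the root; its total mass is the probability of this event.
\<close>
definition extinct_law where
  "extinct_law n = (sub_cavity_op ^^ n) (null_measure interval_borel)"

lemma extinct_law_0: "extinct_law 0 = null_measure interval_borel"
  and extinct_law_Suc: "extinct_law (Suc n) = sub_cavity_op (extinct_law n)"
  by (simp_all add: extinct_law_def)

lemma sets_extinct_law [simp]: "sets (extinct_law n) = sets interval_borel"
  by (cases n) (simp_all add: extinct_law_0 extinct_law_Suc)

lemma space_extinct_law [simp]: "space (extinct_law n) = {-1..1}"
  using sets_eq_imp_space_eq[OF sets_extinct_law] by simp

lemma subprob_extinct_law: "subprob_space (extinct_law n)"
proof (induction n)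
  case 0
  show ?case by (rule subprob_spaceI) (auto simp: extinct_law_0)
next
  case (Suc n)
  then show ?case unfolding extinct_law_Suc by (intro subprob_space_sub_cavity_op) simp_all
qed

text \<open>
  Both sides are iterates of the same monotone operator, started from the zero measure and from \<open>\<mu>\<close>.
\<close>
lemma extinct_law_le_fixed_point:
  assumes "\<mu> \<in> Pr1" "sub_cavity_op \<mu> = \<mu>"
  shows "extinct_law n \<le> \<mu>"
proof (induction n)
  case 0
  then show ?case using assms by (subst le_measure) (auto simp: extinct_law_0 Pr1_def)
next
  case (Suc n)
  have "sub_cavity_op (extinct_law n) \<le> sub_cavity_op \<mu>"
    using Suc assms(1)
    by (intro sub_cavity_op_mono) (auto simp: Pr1_def subprob_extinct_law prob_space_imp_subprob_space)
  then show ?case by (simp add: extinct_law_Suc assms)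
qed

lemma incseq_extinct_law: "incseq extinct_law"
proof (rule incseq_SucI)
  show "extinct_law n \<le> extinct_law (Suc n)" for n
  proof (induction n)
    case 0
    then show ?case by (subst le_measure) (auto simp: extinct_law_0 extinct_law_Suc)
  next
    case (Suc n)
    then have "sub_cavity_op (extinct_law n) \<le> sub_cavity_op (extinct_law (Suc n))"
      by (intro sub_cavity_op_mono) (auto simp: subprob_extinct_law)
    then show ?case by (simp add: extinct_law_Suc)
  qed
qed

lemma extinct_law_countable_carrier:
  assumes "countable SB" "AE x in B. x \<in> SB" "countable SF" "AE x in F. x \<in> SF"
  shows "\<exists>S. countable S \<and> (AE x in extinct_law n. x \<in> S)"
proof (induction n)
  case 0
  have "{-1..1} \<in> null_sets (extinct_law 0)"
    using sets.top[of interval_borel] by (auto simp: extinct_law_0)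
  then have "AE x in extinct_law 0. x \<in> {}"
    by (rule AE_I') auto
  then show ?case by blast
next
  case (Suc n)
  then obtain S where "countable S" "AE x in extinct_law n. x \<in> S" by blast
  then show ?case
    unfolding extinct_law_Suc
    using sub_cavity_op_countable_carrier[OF assms sets_extinct_law subprob_extinct_law] by blast
qed

text \<open>
  The recursion for extinction probabilities: a tree is extinct by generation \<open>n + 1\<close> if and only if
  the subtrees of all offspring of the root are extinct by generation \<open>n\<close>.
\<close>
lemma measure_extinct_law_Suc:
  "measure (extinct_law (Suc n)) {-1..1} =
    exp (- (\<alpha> * real p) * (1 - measure (extinct_law n) {-1..1} ^ (p - 1)))"
proof -
  interpret subprob_space "extinct_law n" by (rule subprob_extinct_law)
  let ?q = "measure (extinct_law n) {-1..1}"
  have top: "{-1..1} \<in> sets interval_borel"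
    using sets.top[of interval_borel] by simp
  have "emeasure (extinct_law (Suc n)) {-1..1} =
      (\<integral>\<^sup>+N. emeasure (extinct_law n) {-1..1} ^ (N * (p - 1)) \<partial>measure_pmf (poisson_pmf (\<alpha> * real p)))"
    by (simp add: extinct_law_Suc emeasure_sub_cavity_op top subprob_extinct_law cavity_kernel_mass)
  also have "\<dots> = (\<integral>\<^sup>+N. ennreal ((?q ^ (p - 1)) ^ N) \<partial>measure_pmf (poisson_pmf (\<alpha> * real p)))"
    by (simp add: emeasure_eq_measure ennreal_power power_mult[symmetric] mult.commute)
  also have "\<dots> = ennreal (exp (- (\<alpha> * real p) * (1 - ?q ^ (p - 1))))"
    using \<alpha>_pos p_ge_2 by (intro nn_integral_poisson_power) auto
  finally show ?thesis by (simp add: measure_def)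
qed

section \<open>The limit law is the unique fixed point\<close>

definition cavity_limit where
  "cavity_limit = (SUP n. extinct_law n)"

lemma sets_cavity_limit [simp]: "sets cavity_limit = sets interval_borel"
  unfolding cavity_limit_def by (rule sets_SUP) auto

lemma space_cavity_limit [simp]: "space cavity_limit = {-1..1}"
  using sets_eq_imp_space_eq[OF sets_cavity_limit] by simp

text \<open>The supremum of a chain of measures is taken setwise; for a general family it may be larger.\<close>
lemma emeasure_cavity_limit:
  assumes "A \<in> sets interval_borel"
  shows "emeasure cavity_limit A = (SUP n. emeasure (extinct_law n) A)"
proof -
  have "extinct_law m \<le> extinct_law n \<or> extinct_law n \<le> extinct_law m" for m n
    using incseqD[OF incseq_extinct_law] nat_le_linear[of m n] by blast
  then have "Complete_Partial_Order.chain (\<le>) (range extinct_law)"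
    by (auto simp: Complete_Partial_Order.chain_def)
  then show ?thesis
    unfolding cavity_limit_def using assms by (intro emeasure_SUP_chain[where N=interval_borel]) auto
qed

lemma cavity_limit_le:
  assumes "sets \<mu> = sets interval_borel" "\<And>n. extinct_law n \<le> \<mu>"
  shows "cavity_limit \<le> \<mu>"
  using assms by (subst le_measure) (auto simp: emeasure_cavity_limit le_measure intro!: SUP_least)

lemma extinct_law_le_cavity_limit: "extinct_law n \<le> cavity_limit"
  by (subst le_measure) (auto simp: emeasure_cavity_limit intro: SUP_upper)

lemma cavity_limit_in_Pr1:
  assumes "\<alpha> * real p * (real p - 1) \<le> 1"
  shows "cavity_limit \<in> Pr1"
proof -
  let ?q = "\<lambda>n. measure (extinct_law n) {-1..1}"
  interpret subprob_space "extinct_law n" for n by (rule subprob_extinct_law)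
  have top: "{-1..1} \<in> sets interval_borel"
    using sets.top[of interval_borel] by simp
  have "incseq ?q"
    using incseq_extinct_law top by (auto simp: incseq_def le_measure emeasure_eq_measure)
  then have "?q \<longlonglongrightarrow> 1"
    using assms p_ge_2 \<alpha>_pos
    by (intro extinction_iteration_tendsto_1[where c="\<alpha> * real p" and m="p - 1"]
        measure_extinct_law_Suc subprob_measure_le_1) (auto simp: of_nat_diff)
  then have "(\<lambda>n. emeasure (extinct_law n) {-1..1}) \<longlonglongrightarrow> 1"
    unfolding emeasure_eq_measure by (metis ennreal_1 tendsto_ennrealI)
  moreover have "incseq (\<lambda>n. emeasure (extinct_law n) {-1..1})"
    using incseq_extinct_law top by (auto simp: incseq_def le_measure)
  ultimately have "emeasure cavity_limit {-1..1} = 1"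
    using emeasure_cavity_limit[OF top] LIMSEQ_SUP LIMSEQ_unique by metis
  then show ?thesis unfolding Pr1_def by (auto intro!: prob_spaceI)
qed

lemma sub_cavity_op_in_Pr1:
  assumes "\<nu> \<in> Pr1"
  shows "sub_cavity_op \<nu> \<in> Pr1"
proof -
  from assms have \<nu>: "sets \<nu> = sets interval_borel" "prob_space \<nu>" by (auto simp: Pr1_def)
  interpret prob_space \<nu> by fact
  have "emeasure \<nu> {-1..1} = 1"
    using emeasure_space_1 sets_eq_imp_space_eq[OF \<nu>(1)] by simp
  then have "emeasure (sub_cavity_op \<nu>) {-1..1} = 1"
    using sets.top[of interval_borel] \<nu>
    by (simp add: emeasure_sub_cavity_op cavity_kernel_mass prob_space_imp_subprob_space)
  then show ?thesis by (auto simp: Pr1_def intro!: prob_spaceI)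
qed

text \<open>
  Monotonicity puts the image of the limit above every iterate, hence above the limit, and an
  inequality between two probability measures is an equality.
\<close>
lemma cavity_limit_fixed:
  assumes "\<alpha> * real p * (real p - 1) \<le> 1"
  shows "sub_cavity_op cavity_limit = cavity_limit"
proof -
  have Pr1: "cavity_limit \<in> Pr1" "sub_cavity_op cavity_limit \<in> Pr1"
    by (intro sub_cavity_op_in_Pr1 cavity_limit_in_Pr1 assms)+
  have "extinct_law n \<le> sub_cavity_op cavity_limit" for n
  proof -
    have "extinct_law n \<le> extinct_law (Suc n)"
      by (rule incseq_SucD[OF incseq_extinct_law])
    also have "\<dots> \<le> sub_cavity_op cavity_limit"
      unfolding extinct_law_Suc using Pr1
      by (intro sub_cavity_op_mono extinct_law_le_cavity_limit)
        (auto simp: subprob_extinct_law Pr1_def prob_space_imp_subprob_space)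
    finally show ?thesis .
  qed
  then have "cavity_limit \<le> sub_cavity_op cavity_limit"
    by (intro cavity_limit_le) auto
  then have "cavity_limit = sub_cavity_op cavity_limit"
    using Pr1 by (intro prob_space_eq_if_le) (auto simp: Pr1_def)
  then show ?thesis ..
qed

text \<open>Every fixed point dominates all the iterates, hence their supremum, which already has mass \<open>1\<close>.\<close>
lemma fixed_point_unique:
  assumes "\<alpha> * real p * (real p - 1) \<le> 1" "\<mu> \<in> Pr1" "sub_cavity_op \<mu> = \<mu>"
  shows "\<mu> = cavity_limit"
proof -
  have "cavity_limit \<le> \<mu>"
    using assms by (intro cavity_limit_le extinct_law_le_fixed_point) (auto simp: Pr1_def)
  then have "cavity_limit = \<mu>"
    using assms(2) cavity_limit_in_Pr1[OF assms(1)] by (intro prob_space_eq_if_le) (auto simp: Pr1_def)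
  then show ?thesis ..
qed

text \<open>
  Each of the countably many iterates is carried by a countable set, and the union of these sets
  carries their supremum.
\<close>
lemma atomic_cavity_limit:
  assumes "countable SB" "AE x in B. x \<in> SB" "countable SF" "AE x in F. x \<in> SF"
  shows "atomic cavity_limit"
proof -
  obtain S where S: "\<And>n. countable (S n)" "\<And>n. AE x in extinct_law n. x \<in> S n"
    using extinct_law_countable_carrier[OF assms] by metis
  let ?S = "(\<Union>n. S n) \<inter> {-1..1}"
  have countable: "countable ?S" using S by auto
  then have "?S \<in> sets interval_borel" by (rule countable_sets_interval_borel) auto
  then have A: "{-1..1} - ?S \<in> sets interval_borel"
    using sets.compl_sets[of ?S interval_borel] by simp
  have "emeasure (extinct_law n) ({-1..1} - ?S) = 0" for n
  proof -
    have "AE x in extinct_law n. x \<notin> {-1..1} - ?S"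
      using S(2)[of n] by eventually_elim auto
    then have "{-1..1} - ?S \<in> null_sets (extinct_law n)"
      using AE_iff_null_sets[of "{-1..1} - ?S" "extinct_law n"] A by simp
    then show ?thesis by (rule null_setsD1)
  qed
  then have "emeasure cavity_limit ({-1..1} - ?S) = 0"
    using A by (simp add: emeasure_cavity_limit)
  then have "AE x in cavity_limit. x \<in> ?S"
    using A by (intro AE_I'[of "{-1..1} - ?S"]) auto
  then show ?thesis
    using countable by (intro countable_carrier_imp_atomic) (auto intro: countable_sets_interval_borel)
qed

end

section \<open>Atomicity of the fixed point\<close>

theorem proposition1p6:
  fixes M :: "'w measure" and p :: nat and \<alpha> h \<beta> :: real
    and \<theta> :: "'w \<Rightarrow> (nat \<Rightarrow> real) \<Rightarrow> real"
    and a b :: "real \<Rightarrow> 'w \<Rightarrow> real" and \<xi> \<zeta> :: "'w \<Rightarrow> real"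
    and \<xi>s \<zeta>s :: "real \<Rightarrow> nat \<Rightarrow> 'w \<Rightarrow> real"
  assumes "prob_space M"
    and "p \<ge> 2" and "\<alpha> > 0" and "\<beta> > 0"
    and "\<And>x. x \<in> cube p \<Longrightarrow> (\<lambda>\<omega>. \<theta> \<omega> x) \<in> borel_measurable M"
    and "integrable M (\<lambda>\<omega>. (sup_norm p (\<theta> \<omega>))\<^sup>2)"
    and "integrable M (\<lambda>\<omega>. Lip p (\<theta> \<omega>))"
    and "\<alpha> * real p * (real p - 1) \<le> 1"
    and "franz_leone M p \<theta> a b \<xi> \<zeta> \<xi>s \<zeta>s"
    and "atomic (distr M borel (b \<beta>))"
    and "atomic (distr M borel \<zeta>)"
    and "atomic (distr M borel \<xi>)"
  shows "let T = cavity_op p \<alpha> h \<beta> (distr M borel (b \<beta>)) (distr M borel (\<lambda>\<omega>. (\<xi> \<omega>, \<zeta> \<omega>)));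
             \<mu>' = cavity_fixed_point p \<alpha> h \<beta> (distr M borel (b \<beta>)) (distr M borel (\<lambda>\<omega>. (\<xi> \<omega>, \<zeta> \<omega>)))
         in (\<exists>!\<mu>. \<mu> \<in> Pr1 \<and> T \<mu> = \<mu>) \<and> \<mu>' \<in> Pr1 \<and> atomic \<mu>'"
proof -
  let ?B = "distr M borel (b \<beta>)" and ?F = "distr M borel (\<lambda>\<omega>. (\<xi> \<omega>, \<zeta> \<omega>))"
  interpret prob_space M by fact
  have "indep_var borel (\<lambda>\<omega>. (a \<beta> \<omega>, b \<beta> \<omega>)) borel (\<lambda>\<omega>. (\<xi> \<omega>, \<zeta> \<omega>))"
    using \<open>franz_leone M p \<theta> a b \<xi> \<zeta> \<xi>s \<zeta>s\<close> \<open>\<beta> > 0\<close> unfolding franz_leone_def by blast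
  then have ab: "(\<lambda>\<omega>. (a \<beta> \<omega>, b \<beta> \<omega>)) \<in> borel_measurable M"
    and f: "(\<lambda>\<omega>. (\<xi> \<omega>, \<zeta> \<omega>)) \<in> borel_measurable M"
    by (blast dest: indep_var_rv1 indep_var_rv2)+
  have b: "b \<beta> \<in> borel_measurable M"
    using measurable_compose[OF ab, of snd borel]
    by (simp add: borel_measurable_continuous_onI continuous_on_snd)
  have \<xi>: "\<xi> \<in> borel_measurable M" and \<zeta>: "\<zeta> \<in> borel_measurable M"
    using measurable_compose[OF f, of fst borel] measurable_compose[OF f, of snd borel]
    by (simp_all add: borel_measurable_continuous_onI continuous_on_fst continuous_on_snd)
  interpret cavity_model p \<alpha> h \<beta> ?B ?F
    by (intro cavity_model.intro prob_space_distr b f assms sets_distr)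
  obtain Sb where Sb: "countable Sb" "AE \<omega> in M. b \<beta> \<omega> \<in> Sb"
    using atomic_distr_imp_countable_AE[OF b] assms(10) by auto
  obtain S\<xi> where S\<xi>: "countable S\<xi>" "AE \<omega> in M. \<xi> \<omega> \<in> S\<xi>"
    using atomic_distr_imp_countable_AE[OF \<xi>] assms(12) by auto
  obtain S\<zeta> where S\<zeta>: "countable S\<zeta>" "AE \<omega> in M. \<zeta> \<omega> \<in> S\<zeta>"
    using atomic_distr_imp_countable_AE[OF \<zeta>] assms(11) by auto
  have SF: "countable (S\<xi> \<times> S\<zeta>)" using S\<xi> S\<zeta> by auto
  have AE_b: "AE x in ?B. x \<in> Sb"
    by (rule AE_distr_countable[OF b Sb])
  have "AE \<omega> in M. (\<xi> \<omega>, \<zeta> \<omega>) \<in> S\<xi> \<times> S\<zeta>"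
    using S\<xi>(2) S\<zeta>(2) by eventually_elim auto
  then have AE_f: "AE x in ?F. x \<in> S\<xi> \<times> S\<zeta>"
    by (rule AE_distr_countable[OF f SF])
  have atomic: "atomic cavity_limit"
    by (rule atomic_cavity_limit[OF Sb(1) AE_b SF AE_f])
  have crit: "\<alpha> * real p * (real p - 1) \<le> 1" by fact
  have fixed: "cavity_limit \<in> Pr1" "cavity_op p \<alpha> h \<beta> ?B ?F cavity_limit = cavity_limit"
    using cavity_limit_in_Pr1[OF crit] cavity_limit_fixed[OF crit]
    by (simp_all add: cavity_op_eq_sub_cavity_op)
  have unique: "\<mu> = cavity_limit" if "\<mu> \<in> Pr1" "cavity_op p \<alpha> h \<beta> ?B ?F \<mu> = \<mu>" for \<mu>
    using fixed_point_unique[OF crit that(1)] that by (simp add: cavity_op_eq_sub_cavity_op)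
  have "cavity_fixed_point p \<alpha> h \<beta> ?B ?F = cavity_limit"
    unfolding cavity_fixed_point_def
    by (rule the_equality) (use fixed in simp, rule unique, simp_all)
  moreover have "\<exists>!\<mu>. \<mu> \<in> Pr1 \<and> cavity_op p \<alpha> h \<beta> ?B ?F \<mu> = \<mu>"
    by (rule ex1I[of _ cavity_limit]) (use fixed in simp, rule unique, simp_all)
  ultimately show ?thesis
    using fixed(1) atomic by (simp add: Let_def)
qed

end
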